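(* Let $0<q<1$ and let $\alpha,\beta,\delta\in\mathbb{C}$ with $\delta q^j\neq 1$ for all $j\in\mathbb{Z}$. For each integer $N\ge 0$ let $$B_N(x)=\frac{(1-\alpha q^{x+1})(1-\beta\delta q^{x+1})(1- q^{x-N})(1-\delta q^{x-N})}{(1-\delta q^{2x-N})(1-\delta q^{2x-N+1})},$$ $$D_N(x)=\frac{(\alpha-\delta q^{x-N-1})(\beta q^{N+2} - q^{x+1})(1-q^x)(1-\delta q^x)q^{-N-1}}{(1-\delta q^{2x-N})(1-\delta q^{2x-N-1})},$$ $$B^{(1)}_N(x)=\frac{(1-\alpha q^{x+1})(1-\beta\delta q^{x+1})}{1-\delta q^{2x-N}},\qquad B^{(2)}_N(x)=\frac{(1- q^{x-N})(1-\delta q^{x-N})}{1-\delta q^{2x-N+1}},$$ $$D^{(1)}_N(x)=\frac{(\alpha-\delta q^{x-N-1})(\beta q^{N+2} - q^{x+1})}{1-\delta q^{2x-N}},\qquad D^{(2)}_N(x)=\frac{(1-q^x)(1-\delta q^x)q^{-N-1}}{1-\delta q^{2x-N-1}},$$ so that $B_N=B_N^{(1)}B_N^{(2)}$ and $D_N=D_N^{(1)}D_N^{(2)}$. Then, for all $x=0,1,\dotsc,N$, $$B^{(1)}_{N-1}(x)B^{(2)}_{N-1}(x-1)=B_N(x)\quad (N\ge 1),$$ $$D^{(1)}_{N-1}(x-1)D^{(2)}_{N-1}(x)=D_N(x)\quad (N\ge 1),$$ $$B^{(1)}_{N-1}(x-1)D^{(2)}_{N-1}(x)+D^{(1)}_{N-1}(x)B^{(2)}_{N-1}(x-1)-B_N(x)-D_N(x)=a_N\quad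 (N\ge 1),$$ $$D^{(1)}_N(x)B^{(2)}_N(x-1)+B^{(1)}_N(x)D^{(2)}_N(x+1)-B_N(x)-D_N(x)=b_N\quad (N\ge 0),$$ with $a_N=-(1-q^{-N})(1-\alpha\beta q^{N+1})$ and $b_N=-(1-q^{-N-1})(1-\alpha\beta q^{N+2})$.
   Context: All functions are evaluated at integers $x$ by the displayed formulas. *)

theory Defs
  imports Complex_Main
begin

text \<open>
  The index \<open>N\<close> and the argument \<open>x\<close> are integers, so that \<open>N - 1\<close>, \<open>x - 1\<close> and \<open>x + 1\<close>
  are never truncated, and powers of \<open>q\<close> have integer exponents. The base \<open>q\<close> is
  an arbitrary complex number here; it is to be instantiated with a real number in \<open>(0, 1)\<close>.
\<close>

definition B_fun ::
    "complex \<Rightarrow> complex \<Rightarrow> complex \<Rightarrow> complex \<Rightarrow> int \<Rightarrow> int \<Rightarrow> complex" where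
  "B_fun q \<alpha> \<beta> \<delta> N x =
     ((1 - \<alpha> * q powi (x + 1)) * (1 - \<beta> * \<delta> * q powi (x + 1)) *
      (1 - q powi (x - N)) * (1 - \<delta> * q powi (x - N))) /
     ((1 - \<delta> * q powi (2 * x - N)) * (1 - \<delta> * q powi (2 * x - N + 1)))"

definition D_fun ::
    "complex \<Rightarrow> complex \<Rightarrow> complex \<Rightarrow> complex \<Rightarrow> int \<Rightarrow> int \<Rightarrow> complex" where
  "D_fun q \<alpha> \<beta> \<delta> N x =
     ((\<alpha> - \<delta> * q powi (x - N - 1)) * (\<beta> * q powi (N + 2) - q powi (x + 1)) *
      (1 - q powi x) * (1 - \<delta> * q powi x) * q powi (- N - 1)) /
     ((1 - \<delta> * q powi (2 * x - N)) * (1 - \<delta> * q powi (2 * x - N - 1)))"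

definition B1_fun ::
    "complex \<Rightarrow> complex \<Rightarrow> complex \<Rightarrow> complex \<Rightarrow> int \<Rightarrow> int \<Rightarrow> complex" where
  "B1_fun q \<alpha> \<beta> \<delta> N x =
     ((1 - \<alpha> * q powi (x + 1)) * (1 - \<beta> * \<delta> * q powi (x + 1))) /
     (1 - \<delta> * q powi (2 * x - N))"

definition B2_fun :: "complex \<Rightarrow> complex \<Rightarrow> int \<Rightarrow> int \<Rightarrow> complex" where
  "B2_fun q \<delta> N x =
     ((1 - q powi (x - N)) * (1 - \<delta> * q powi (x - N))) /
     (1 - \<delta> * q powi (2 * x - N + 1))"

definition D1_fun ::
    "complex \<Rightarrow> complex \<Rightarrow> complex \<Rightarrow> complex \<Rightarrow> int \<Rightarrow> int \<Rightarrow> complex" where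
  "D1_fun q \<alpha> \<beta> \<delta> N x =
     ((\<alpha> - \<delta> * q powi (x - N - 1)) * (\<beta> * q powi (N + 2) - q powi (x + 1))) /
     (1 - \<delta> * q powi (2 * x - N))"

definition D2_fun :: "complex \<Rightarrow> complex \<Rightarrow> int \<Rightarrow> int \<Rightarrow> complex" where
  "D2_fun q \<delta> N x =
     ((1 - q powi x) * (1 - \<delta> * q powi x) * q powi (- N - 1)) /
     (1 - \<delta> * q powi (2 * x - N - 1))"

definition a_coef :: "complex \<Rightarrow> complex \<Rightarrow> complex \<Rightarrow> int \<Rightarrow> complex" where
  "a_coef q \<alpha> \<beta> N = - (1 - q powi (- N)) * (1 - \<alpha> * \<beta> * q powi (N + 1))"

definition b_coef :: "complex \<Rightarrow> complex \<Rightarrow> complex \<Rightarrow> int \<Rightarrow> complex" where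
  "b_coef q \<alpha> \<beta> N = - (1 - q powi (- N - 1)) * (1 - \<alpha> * \<beta> * q powi (N + 2))"

end

theory Submission
  imports Defs
begin

text \<open>
  Put \<open>z = q\<^bsup>x-N-1\<^esup>\<close> and \<open>m = q\<^bsup>N\<^esup>\<close>. Every power of \<open>q\<close> that occurs is a monomial in
  \<open>q\<close>, \<open>z\<close>, \<open>m\<close>, \<open>m\<^bsup>-1\<^esup>\<close>, so the four relations are identities between rational functions
  of \<open>q, z, m, \<alpha>, \<beta>, \<delta>\<close>. They hold wherever the denominators \<open>1 - \<delta>q\<^bsup>2x-N+i\<^esup>\<close>,
  \<open>i = -1, 0, 1\<close>, do not vanish.
\<close>

text \<open>This is the relation for \<open>a\<close> in the variables \<open>z\<close> and
  \<open>m\<close>, with \<open>q\<close> for the base. The four fractions are, in order,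
  \<open>B1 (N - 1) (x - 1) * D2 (N - 1) x\<close>,
  \<open>D1 (N - 1) x * B2 (N - 1) (x - 1)\<close>, \<open>B N x\<close> and
  \<open>D N x\<close>.\<close>

lemma rational_identity_a:
  fixes q z m \<alpha> \<beta> \<delta> :: "'a::field"
  assumes "m \<noteq> 0" "1 - \<delta> * q * z^2 * m \<noteq> 0" "1 - \<delta> * q^2 * z^2 * m \<noteq> 0" "1 - \<delta> * q^3 * z^2 * m \<noteq> 0"
  shows "((1 - \<alpha>*q*z*m) * (1 - \<beta>*\<delta>*q*z*m) * (1 - q*z*m) * (1 - \<delta>*q*z*m)) /
           (m * ((1 - \<delta> * q * z^2 * m) * (1 - \<delta> * q^2 * z^2 * m)))
       + ((\<alpha> - \<delta>*q*z) * (\<beta> - q*z) * q * m * (1 - q*z) * (1 - \<delta>*q*z)) /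
           ((1 - \<delta> * q^3 * z^2 * m) * (1 - \<delta> * q^2 * z^2 * m))
       - ((1 - \<alpha>*q^2*z*m) * (1 - \<beta>*\<delta>*q^2*z*m) * (1 - q*z) * (1 - \<delta>*q*z)) /
           ((1 - \<delta> * q^2 * z^2 * m) * (1 - \<delta> * q^3 * z^2 * m))
       - ((\<alpha> - \<delta>*z) * (\<beta> - z) * q * (1 - q*z*m) * (1 - \<delta>*q*z*m)) /
           ((1 - \<delta> * q^2 * z^2 * m) * (1 - \<delta> * q * z^2 * m))
       = - (1 - 1/m) * (1 - \<alpha>*\<beta>*q*m)"
proof -
  \<comment> \<open>Naming the three denominators keeps them atomic while fractions are cleared. The
    resulting polynomial equation holds only modulo their definitions, since all three come from the
    same product \<delta> z^2 m; \<open>algebra\<close> therefore receives these as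
    relations.\<close>
  define r s t where "r = 1 - \<delta> * q * z^2 * m" and "s = 1 - \<delta> * q^2 * z^2 * m" and "t = 1 - \<delta> * q^3 * z^2 * m"
  have nz: "m \<noteq> 0" "r \<noteq> 0" "s \<noteq> 0" "t \<noteq> 0"
    using assms by (simp_all add: r_def s_def t_def)
  show ?thesis
    unfolding r_def[symmetric] s_def[symmetric] t_def[symmetric] using nz
    by (simp add: divide_simps) (algebra add: r_def s_def t_def)
qed

text \<open>The same for \<open>b\<close>: only the first two fractions change, to
  \<open>D1 N x * B2 N (x - 1)\<close> and \<open>B1 N x * D2 N (x + 1)\<close>. The factor q^(-N-1)
  = 1/(q m) in the latter is why \<open>q\<close> must be nonzero.\<close>

lemma rational_identity_b:
  fixes q z m \<alpha> \<beta> \<delta> :: "'a::field"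
  assumes "m \<noteq> 0" "q \<noteq> 0" "1 - \<delta> * q * z^2 * m \<noteq> 0" "1 - \<delta> * q^2 * z^2 * m \<noteq> 0" "1 - \<delta> * q^3 * z^2 * m \<noteq> 0"
  shows "((\<alpha> - \<delta>*z) * (\<beta> - z) * q^2 * m * (1 - z) * (1 - \<delta>*z)) /
           ((1 - \<delta> * q^2 * z^2 * m) * (1 - \<delta> * q * z^2 * m))
       + ((1 - \<alpha>*q^2*z*m) * (1 - \<beta>*\<delta>*q^2*z*m) * (1 - q^2*z*m) * (1 - \<delta>*q^2*z*m)) /
           (q * m * ((1 - \<delta> * q^2 * z^2 * m) * (1 - \<delta> * q^3 * z^2 * m)))
       - ((1 - \<alpha>*q^2*z*m) * (1 - \<beta>*\<delta>*q^2*z*m) * (1 - q*z) * (1 - \<delta>*q*z)) /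
           ((1 - \<delta> * q^2 * z^2 * m) * (1 - \<delta> * q^3 * z^2 * m))
       - ((\<alpha> - \<delta>*z) * (\<beta> - z) * q * (1 - q*z*m) * (1 - \<delta>*q*z*m)) /
           ((1 - \<delta> * q^2 * z^2 * m) * (1 - \<delta> * q * z^2 * m))
       = - (1 - 1/(q*m)) * (1 - \<alpha>*\<beta>*q^2*m)"
proof -
  define r s t where "r = 1 - \<delta> * q * z^2 * m" and "s = 1 - \<delta> * q^2 * z^2 * m" and "t = 1 - \<delta> * q^3 * z^2 * m"
  have nz: "m \<noteq> 0" "q \<noteq> 0" "r \<noteq> 0" "s \<noteq> 0" "t \<noteq> 0"
    using assms by (simp_all add: r_def s_def t_def)
  show ?thesis
    unfolding r_def[symmetric] s_def[symmetric] t_def[symmetric] using nz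
    by (simp add: divide_simps) (algebra add: r_def s_def t_def)
qed

theorem proposition5p1:
  fixes q :: real and \<alpha> \<beta> \<delta> :: complex
  assumes "0 < q" and "q < 1"
    and "\<forall>j::int. \<delta> * complex_of_real q powi j \<noteq> 1"
  defines "B \<equiv> B_fun (complex_of_real q) \<alpha> \<beta> \<delta>"
    and "D \<equiv> D_fun (complex_of_real q) \<alpha> \<beta> \<delta>"
    and "B1 \<equiv> B1_fun (complex_of_real q) \<alpha> \<beta> \<delta>"
    and "B2 \<equiv> B2_fun (complex_of_real q) \<delta>"
    and "D1 \<equiv> D1_fun (complex_of_real q) \<alpha> \<beta> \<delta>"
    and "D2 \<equiv> D2_fun (complex_of_real q) \<delta>"
    and "a \<equiv> a_coef (complex_of_real q) \<alpha> \<beta>"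
    and "b \<equiv> b_coef (complex_of_real q) \<alpha> \<beta>"
  shows "(\<forall>N\<ge>0. \<forall>x. B N x = B1 N x * B2 N x \<and> D N x = D1 N x * D2 N x) \<and>
    (\<forall>N\<ge>1. \<forall>x\<in>{0..N}. B1 (N - 1) x * B2 (N - 1) (x - 1) = B N x) \<and>
    (\<forall>N\<ge>1. \<forall>x\<in>{0..N}. D1 (N - 1) (x - 1) * D2 (N - 1) x = D N x) \<and>
    (\<forall>N\<ge>1. \<forall>x\<in>{0..N}.
       B1 (N - 1) (x - 1) * D2 (N - 1) x + D1 (N - 1) x * B2 (N - 1) (x - 1)
         - B N x - D N x = a N) \<and>
    (\<forall>N\<ge>0. \<forall>x\<in>{0..N}.
       D1 N x * B2 N (x - 1) + B1 N x * D2 N (x + 1) - B N x - D N x = b N)"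
proof -
  define Q where "Q = complex_of_real q"
  have Q: "Q \<noteq> 0" using assms(1) by (simp add: Q_def)
  have nz: "\<delta> * Q powi j \<noteq> 1" for j using assms(3) by (simp add: Q_def)
  have B: "B N x = B1 N x * B2 N x" and D: "D N x = D1 N x * D2 N x" for N x
    by (simp_all add: B_def D_def B1_def B2_def D1_def D2_def
        B_fun_def D_fun_def B1_fun_def B2_fun_def D1_fun_def D2_fun_def)
  \<comment> \<open>The shifts keep the numerators, as (x-1) - (N-1) = x - N, and merely exchange
    the two denominators.\<close>
  have B': "B1 (N - 1) x * B2 (N - 1) (x - 1) = B N x" for N x
    by (simp add: B_def B1_def B2_def B_fun_def B1_fun_def B2_fun_def algebra_simps)
  have D': "D1 (N - 1) (x - 1) * D2 (N - 1) x = D N x" for N x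
  proof -
    \<comment> \<open>Besides exchanging the denominators, the shifts take a factor \<open>Q\<close>
      out of the \<beta> factor and put it into the power of \<open>Q\<close> in \<open>D2\<close>;
      these two equations record that balance.\<close>
    have "\<beta> * Q powi (N + 2) - Q powi (x + 1) = Q * (\<beta> * Q powi (N + 1) - Q powi x)"
      "Q powi (- N) = Q * Q powi (- N - 1)"
      using Q by (simp_all add: power_int_add power_int_diff power2_eq_square algebra_simps)
    moreover have "x - 1 + 1 = x" "x - 1 - (N - 1) - 1 = x - N - 1" "N - 1 + 2 = N + 1"
      "- (N - 1) - 1 = - N" "2 * (x - 1) - (N - 1) = 2 * x - N - 1" "2 * x - (N - 1) - 1 = 2 * x - N"
      by simp_all
    ultimately show ?thesis
      unfolding D_def D1_def D2_def D_fun_def D1_fun_def D2_fun_def Q_def[symmetric]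
      by (simp only: times_divide_times_eq mult_ac)
  qed
  have a: "B1 (N - 1) (x - 1) * D2 (N - 1) x + D1 (N - 1) x * B2 (N - 1) (x - 1)
         - B N x - D N x = a N" (is ?a)
    and b: "D1 N x * B2 N (x - 1) + B1 N x * D2 N (x + 1) - B N x - D N x = b N" (is ?b) for N x
  proof -
    define z m where "z = Q powi (x - N - 1)" and "m = Q powi N"
    have m: "m \<noteq> 0" using Q by (simp add: m_def)
    \<comment> \<open>Each exponent below is an integer combination of x-N-1, N and 1; for instance
      2x-N = 2(x-N-1) + N + 2 gives the instance \<open>pw[of 2 1 2]\<close>.\<close>
    have pw: "Q powi (i * (x - N - 1) + j * N + k) = z powi i * m powi j * Q powi k" for i j k
      using Q by (simp add: z_def m_def power_int_add flip: power_int_mult) (simp add: mult.commute)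
    have x: "Q powi x = Q*z*m" "Q powi (x + 1) = Q^2*z*m" and
      xN: "Q powi (x - N) = Q*z" "Q powi (x - N - 1) = z" and
      N: "Q powi (N + 1) = Q*m" "Q powi (N + 2) = Q^2*m"
         "Q powi (- N) = 1/m" "Q powi (- N - 1) = 1/(Q*m)" and
      d: "Q powi (2*x - N - 1) = Q * z^2 * m" "Q powi (2*x - N) = Q^2 * z^2 * m"
         "Q powi (2*x - N + 1) = Q^3 * z^2 * m"
      using pw[of 1 1 1] pw[of 1 1 2] pw[of 1 0 1] pw[of 1 0 0] pw[of 0 1 1] pw[of 0 1 2]
        pw[of 0 "-1" 0] pw[of 0 "-1" "-1"] pw[of 2 1 1] pw[of 2 1 2] pw[of 2 1 3]
      by (simp_all add: power_int_minus field_simps minus_diff_commute)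
    have nz': "1 - \<delta> * Q * z^2 * m \<noteq> 0" "1 - \<delta> * Q^2 * z^2 * m \<noteq> 0" "1 - \<delta> * Q^3 * z^2 * m \<noteq> 0"
      using nz[of "2*x - N - 1"] nz[of "2*x - N"] nz[of "2*x - N + 1"] unfolding d
      by (simp_all add: mult.assoc)
    have BN: "B N x = ((1 - \<alpha>*Q^2*z*m) * (1 - \<beta>*\<delta>*Q^2*z*m) * (1 - Q*z) * (1 - \<delta>*Q*z)) /
           ((1 - \<delta> * Q^2 * z^2 * m) * (1 - \<delta> * Q^3 * z^2 * m))"
      unfolding B_def B_fun_def Q_def[symmetric] x xN d by (simp add: mult.assoc)
    \<comment> \<open>The common factor is q^(N+2). In \<open>D N x\<close> the factor q^(-N-1)
      reduces it to \<open>Q\<close>; in \<open>D1 N x * B2 N (x - 1)\<close> it survives as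
      \<open>Q^2 * m\<close>.\<close>
    have \<beta>: "\<beta> * (Q^2*m) - Q^2*z*m = (\<beta> - z) * Q * (Q*m)"
      by (simp add: algebra_simps power2_eq_square)
    have DN: "D N x = ((\<alpha> - \<delta>*z) * (\<beta> - z) * Q * (1 - Q*z*m) * (1 - \<delta>*Q*z*m)) /
           ((1 - \<delta> * Q^2 * z^2 * m) * (1 - \<delta> * Q * z^2 * m))"
      unfolding D_def D_fun_def Q_def[symmetric] x xN N d \<beta> using Q m by (simp add: mult_ac)
    \<comment> \<open>After the shifts every exponent is again one of those already expressed
      through \<open>z\<close> and \<open>m\<close>, so no further denominators arise.\<close>
    have sh: "x - 1 + 1 = x" "2 * (x - 1) - (N - 1) = 2*x - N - 1" "- (N - 1) - 1 = - N"
      "2*x - N + 1 - 1 = 2*x - N" "x - (N - 1) - 1 = x - N" "N - 1 + 2 = N + 1"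
      "2*x - (N - 1) = 2*x - N + 1" "x - 1 - (N - 1) = x - N" "2*x - N - 1 + 1 = 2*x - N"
      "x - 1 - N = x - N - 1" "2*(x - 1) - N + 1 = 2*x - N - 1" "2*(x + 1) - N - 1 = 2*x - N + 1"
      by simp_all
    have "B1 (N - 1) (x - 1) * D2 (N - 1) x =
        ((1 - \<alpha>*Q*z*m) * (1 - \<beta>*\<delta>*Q*z*m) * (1 - Q*z*m) * (1 - \<delta>*Q*z*m)) /
           (m * ((1 - \<delta> * Q * z^2 * m) * (1 - \<delta> * Q^2 * z^2 * m)))"
      unfolding B1_def B1_fun_def D2_def D2_fun_def Q_def[symmetric] sh x N d
      by (simp add: mult_ac)
    moreover have "D1 (N - 1) x * B2 (N - 1) (x - 1) =
        ((\<alpha> - \<delta>*Q*z) * (\<beta> - Q*z) * Q * m * (1 - Q*z) * (1 - \<delta>*Q*z)) /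
           ((1 - \<delta> * Q^3 * z^2 * m) * (1 - \<delta> * Q^2 * z^2 * m))"
    proof -
      \<comment> \<open>The analogous factorisation at index N-1, where the common factor is
        q^(N+1).\<close>
      have "\<beta> * (Q*m) - Q^2*z*m = (\<beta> - Q*z) * (Q * m)"
        by (simp add: algebra_simps power2_eq_square)
      then show ?thesis
        unfolding D1_def D1_fun_def B2_def B2_fun_def Q_def[symmetric] sh x xN N d
        by (simp add: mult_ac)
    qed
    moreover have "a N = - (1 - 1/m) * (1 - \<alpha>*\<beta>*Q*m)"
      unfolding a_def a_coef_def Q_def[symmetric] N by (simp add: mult.assoc)
    ultimately show ?a
      using rational_identity_a[OF m nz', of \<alpha> \<beta>] BN DN by (simp only:)
    have "D1 N x * B2 N (x - 1) =
        ((\<alpha> - \<delta>*z) * (\<beta> - z) * Q^2 * m * (1 - z) * (1 - \<delta>*z)) /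
           ((1 - \<delta> * Q^2 * z^2 * m) * (1 - \<delta> * Q * z^2 * m))"
      unfolding D1_def D1_fun_def B2_def B2_fun_def Q_def[symmetric] sh x xN N d \<beta>
      by (simp add: mult_ac power2_eq_square)
    moreover have "B1 N x * D2 N (x + 1) =
        ((1 - \<alpha>*Q^2*z*m) * (1 - \<beta>*\<delta>*Q^2*z*m) * (1 - Q^2*z*m) * (1 - \<delta>*Q^2*z*m)) /
           (Q * m * ((1 - \<delta> * Q^2 * z^2 * m) * (1 - \<delta> * Q^3 * z^2 * m)))"
      unfolding B1_def B1_fun_def D2_def D2_fun_def Q_def[symmetric] sh x N d
      by (simp add: mult_ac)
    moreover have "b N = - (1 - 1/(Q*m)) * (1 - \<alpha>*\<beta>*Q^2*m)"
      unfolding b_def b_coef_def Q_def[symmetric] N by (simp add: mult.assoc)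
    ultimately show ?b
      using rational_identity_b[OF m Q nz', of \<alpha> \<beta>] BN DN by (simp only:)
  qed
  show ?thesis
    using B D B' D' a b by blast
qed

end
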